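(* Let $m=(m(p))_{p\ge0}$ be a sequence of positive real numbers with $m(0)=1$ and let $n\ge1$ be an integer. Consider the moment differential equation $$(x+1)\,\partial_my(x)-m(1)\,y(x)=0\quad\text{if }n=1,$$ $$x^2\,\partial_m^2y(x)+2(x+1)\,\partial_my(x)-\lambda_n^B\,y(x)=0\quad\text{if }n\ge2,\qquad\text{where }\lambda_n^B:=\frac{m(n)}{m(n-1)}\left[\frac{m(n-1)}{m(n-2)}+2\right].$$ Then this equation has a polynomial solution $y_{B,m}$ of degree $n$, given (with $a_0\ne0$ an arbitrary constant) by $$y_{B,m}(x)=a_0(1+x)\quad\text{for }n=1,$$ $$y_{B,m}(x)=a_0\left(1+\frac{(2+m(1))m(2)}{2m(1)^2}x+\frac{(2+m(1))\left(-2m(1)^2+(2+m(1))m(2)\right)}{4m(1)^2}x^2\right)\quad\text{for }n=2,$$ and, for $n\ge3$, $$y_{B,m}(x)=a_0\left[1+\frac{\lambda_n^B}{2m(1)}x+\frac{\lambda_n^B}{4m(2)}\left(\lambda_n^B-2m(1)\right)x^2+\frac{\lambda_n^B}{4m(2)}\left(\lambda_n^B-2m(1)\right)\sum_{p=3}^n\left(\prod_{j=2}^{p-1}\frac{\lambda_n^B-\frac{m(j)}{m(j-1)}\left[\frac{m(j-1)}{m(j-2)}+2\right]}{\frac{2m(j+1)}{m(j)}}\right)x^p\right].$$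
   Context: For a sequence $m=(m(p))_{p\ge0}$ of positive reals, the moment derivative $\partial_m:\mathbb{C}[[x]]\to\mathbb{C}[[x]]$ is defined by $\partial_m\left(\sum_{p\ge0}\frac{a_p}{m(p)}x^p\right)=\sum_{p\ge0}\frac{a_{p+1}}{m(p)}x^p$; equivalently $\partial_m1=0$ and $\partial_mx^p=\frac{m(p)}{m(p-1)}x^{p-1}$ for $p\ge1$. $\partial_m^2=\partial_m\circ\partial_m$.
   Formalization: "Of degree n" fails for some m (m = 1 constantly, n = 3 gives degree 2); the formula is shown to be a solution of degree at most n, with degree exactly n if and only if n = 1, or λ_n^B ≠ 2m(1) and λ_n^B ≠ λ_j^B for all 2 ≤ j < n. *)

theory Defs
  imports Complex_Main "HOL-Computational_Algebra.Polynomial_FPS"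
begin

text \<open>For a series with coefficients \<open>f\<^sub>p = a\<^sub>p / m(p)\<close> one has \<open>a\<^sub>p = m(p) f\<^sub>p\<close>, which gives the
  formula below; see \<open>moment_deriv_Abs_fps\<close> and \<open>moment_deriv_X_power\<close>.\<close>

definition moment_deriv :: "(nat \<Rightarrow> real) \<Rightarrow> complex fps \<Rightarrow> complex fps" where
  "moment_deriv m f =
     Abs_fps (\<lambda>p. complex_of_real (m (p + 1)) * fps_nth f (p + 1) / complex_of_real (m p))"

lemma moment_deriv_Abs_fps:
  assumes "\<And>p. m p > 0"
  shows "moment_deriv m (Abs_fps (\<lambda>p. a p / complex_of_real (m p))) =
           Abs_fps (\<lambda>p. a (p + 1) / complex_of_real (m p))"
proof -
  have "m p \<noteq> 0" for p
    using assms[of p] by simp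
  then show ?thesis
    by (simp add: moment_deriv_def fps_eq_iff)
qed

lemma moment_deriv_1: "moment_deriv m 1 = 0"
  by (simp add: moment_deriv_def fps_eq_iff)

lemma moment_deriv_X_power:
  assumes "p \<ge> 1"
  shows "moment_deriv m (fps_X ^ p) =
           fps_const (complex_of_real (m p / m (p - 1))) * fps_X ^ (p - 1)"
  using assms by (cases p) (auto simp: moment_deriv_def fps_eq_iff fps_X_power_nth)

text \<open>Only meaningful for \<open>n \<ge> 2\<close>, where the subtractions do not truncate.\<close>

definition eigval_B :: "(nat \<Rightarrow> real) \<Rightarrow> nat \<Rightarrow> real" where
  "eigval_B m n = m n / m (n - 1) * (m (n - 1) / m (n - 2) + 2)"

definition moment_Bessel_eq :: "(nat \<Rightarrow> real) \<Rightarrow> nat \<Rightarrow> complex fps \<Rightarrow> bool" where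
  "moment_Bessel_eq m n y \<longleftrightarrow>
     (if n = 1
      then (fps_X + 1) * moment_deriv m y - fps_const (complex_of_real (m 1)) * y = 0
      else fps_X ^ 2 * moment_deriv m (moment_deriv m y)
           + 2 * (fps_X + 1) * moment_deriv m y
           - fps_const (complex_of_real (eigval_B m n)) * y = 0)"

definition moment_Bessel_poly :: "(nat \<Rightarrow> real) \<Rightarrow> nat \<Rightarrow> complex \<Rightarrow> complex poly" where
  "moment_Bessel_poly m n a0 =
     (if n = 1 then smult a0 [:1, 1:]
      else if n = 2 then
        smult a0
          [:1,
            complex_of_real ((2 + m 1) * m 2 / (2 * m 1 ^ 2)),
            complex_of_real
              ((2 + m 1) * (- 2 * m 1 ^ 2 + (2 + m 1) * m 2) / (4 * m 1 ^ 2)):]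
      else
        smult a0
          (1
           + monom (complex_of_real (eigval_B m n / (2 * m 1))) 1
           + monom (complex_of_real (eigval_B m n / (4 * m 2) * (eigval_B m n - 2 * m 1))) 2
           + smult (complex_of_real (eigval_B m n / (4 * m 2) * (eigval_B m n - 2 * m 1)))
               (\<Sum>p = 3..n.
                  monom
                    (complex_of_real
                      (\<Prod>j = 2..p - 1.
                         (eigval_B m n - m j / m (j - 1) * (m (j - 1) / m (j - 2) + 2))
                         / (2 * m (j + 1) / m j)))
                    p)))"

text \<open>The operator \<open>x\<^sup>2 \<partial>\<^sub>m\<^sup>2 + 2 (x + 1) \<partial>\<^sub>m\<close> maps \<open>x\<^sup>j\<close> to \<open>\<mu>\<^sub>j x\<^sup>j\<close> plus a multiple of \<open>x\<^sup>j\<^sup>-\<^sup>1\<close>, where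
  \<open>\<mu>\<^sub>1 = 2 m(1)\<close> (as \<open>m(0) = 1\<close>) and \<open>\<mu>\<^sub>j = eigval_B m j\<close> for \<open>j \<ge> 2\<close>. For arbitrary positive \<open>m\<close>
  the value \<open>\<mu>\<^sub>n\<close> may coincide with an earlier one (for instance \<open>m = (\<lambda>_. 1)\<close>, \<open>n = 3\<close>), and then no
  polynomial of degree exactly \<open>n\<close> solves the equation. The following condition excludes this;
  it is vacuous for \<open>n = 1\<close>.\<close>

definition nonresonant_B :: "(nat \<Rightarrow> real) \<Rightarrow> nat \<Rightarrow> bool" where
  "nonresonant_B m n \<longleftrightarrow>
     (n \<ge> 2 \<longrightarrow> eigval_B m n \<noteq> 2 * m 1 \<and> (\<forall>j\<in>{2..<n}. eigval_B m n \<noteq> eigval_B m j))"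

end

theory Submission imports Defs begin

text \<open>Comparing coefficients of \<open>x\<^sup>p\<close>, the operator \<open>x\<^sup>2 \<partial>\<^sub>m\<^sup>2 + 2 (x + 1) \<partial>\<^sub>m\<close> turns the equation for
  \<open>n \<ge> 2\<close> into the two-term recurrence \<open>(\<mu>\<^sub>p - \<lambda>) c\<^sub>p + 2 m(p+1)/m(p) c\<^bsub>p+1\<^esub> = 0\<close> with \<open>\<lambda> = \<mu>\<^sub>n\<close>.
  Hence \<open>c\<^sub>p\<close> is \<open>c\<^sub>0\<close> times a product over \<open>j < p\<close> whose \<open>j\<close>-th factor vanishes iff \<open>\<mu>\<^sub>j = \<lambda>\<close>. The factor
  \<open>j = n\<close> ends the series, and \<open>c\<^sub>n \<noteq> 0\<close> is exactly nonresonance.\<close>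

text \<open>These are the \<mu>_p. Indices 0 and 1 are separate because truncated subtraction would
  make \<open>eigval_B\<close> equal to 3 and \<open>3 * m 1\<close> there when
  \<open>m 0 = 1\<close>.\<close>

definition diag_B :: "(nat \<Rightarrow> real) \<Rightarrow> nat \<Rightarrow> real" where
  "diag_B m p = (if p = 0 then 0 else if p = 1 then 2 * m 1 else eigval_B m p)"

definition ratio_B :: "(nat \<Rightarrow> real) \<Rightarrow> real \<Rightarrow> nat \<Rightarrow> real" where
  "ratio_B m l j = (l - diag_B m j) / (2 * m (j + 1) / m j)"

definition coeff_B :: "(nat \<Rightarrow> real) \<Rightarrow> real \<Rightarrow> nat \<Rightarrow> real" where
  "coeff_B m l p = (\<Prod>j<p. ratio_B m l j)"

text \<open>For p \<ge> 2 the second-order term contributes m(p)/m(p-2) and the term 2x \<partial>_m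
  contributes 2m(p)/m(p-1), which add up to \<open>eigval_B m p\<close>. Below degree 2 the
  second-order term is absent.\<close>

lemma Bessel_operator_nth:
  assumes pos: "\<And>p. m p > 0" and m0: "m 0 = 1"
  shows "fps_nth (fps_X ^ 2 * moment_deriv m (moment_deriv m y)
                  + 2 * (fps_X + 1) * moment_deriv m y) p
       = complex_of_real (diag_B m p) * fps_nth y p
         + complex_of_real (2 * m (p + 1) / m p) * fps_nth y (p + 1)"
proof -
  have nz: "m q \<noteq> 0" for q
    using pos[of q] by simp
  have split: "2 * (fps_X + 1) * z = fps_const 2 * (fps_X * z) + fps_const 2 * z"
    for z :: "complex fps"
    by (simp add: distrib_left distrib_right mult.assoc numeral_fps_const)
  consider "p = 0" | "p = 1" | q where "p = q + 2"
    by (metis One_nat_def add_2_eq_Suc' not0_implies_Suc)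
  then show ?thesis
  proof cases
    case 3
    then show ?thesis
      unfolding split
      by (simp add: fps_X_power_mult_nth moment_deriv_def diag_B_def eigval_B_def nz field_simps)
  qed (unfold split, simp_all add: fps_X_power_mult_nth moment_deriv_def diag_B_def nz m0)
qed

text \<open>Splits off the factors 0 and 1, since the product in the closed formula starts at j =
  2.\<close>

lemma coeff_B_Suc_Suc:
  "coeff_B m l (Suc (Suc q)) = ratio_B m l 0 * ratio_B m l 1 * (\<Prod>j = 2..Suc q. ratio_B m l j)"
proof -
  have "{..<Suc (Suc q)} = {0, 1} \<union> {2..Suc q}"
    by auto
  then show ?thesis
    by (simp add: coeff_B_def prod.union_disjoint)
qed

lemma coeff_B_eq_0:
  assumes "n \<ge> 2" "p > n"
  shows "coeff_B m (eigval_B m n) p = 0"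
  using assms by (auto simp: coeff_B_def ratio_B_def diag_B_def intro!: bexI[of _ n])

lemma coeff_B_small:
  assumes pos: "\<And>p. m p > 0" and m0: "m 0 = 1"
  shows "coeff_B m l 0 = 1" "coeff_B m l 1 = l / (2 * m 1)"
    "coeff_B m l 2 = l / (4 * m 2) * (l - 2 * m 1)"
proof -
  have "m q \<noteq> 0" for q
    using pos[of q] by simp
  then show "coeff_B m l 0 = 1" "coeff_B m l 1 = l / (2 * m 1)"
    "coeff_B m l 2 = l / (4 * m 2) * (l - 2 * m 1)"
    by (simp_all add: coeff_B_def ratio_B_def diag_B_def m0 numeral_2_eq_2)
qed

lemma coeff_B_ge_3:
  assumes pos: "\<And>p. m p > 0" and m0: "m 0 = 1" and p: "p \<ge> 3"
  shows "coeff_B m l p = l / (4 * m 2) * (l - 2 * m 1)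
    * (\<Prod>j = 2..p - 1. (l - m j / m (j - 1) * (m (j - 1) / m (j - 2) + 2)) / (2 * m (j + 1) / m j))"
proof -
  obtain q where q: "p = Suc (Suc q)"
    using p by (metis Suc_le_D numeral_3_eq_3 Suc_le_mono)
  have "coeff_B m l p = coeff_B m l 2 * (\<Prod>j = 2..p - 1. ratio_B m l j)"
    \<comment> \<open>For q = 0 the product over \<open>{2..1}\<close> is empty, so
      \<open>coeff_B m l 2\<close> is the product of the first two ratios.\<close>
    using coeff_B_Suc_Suc[of m l 0] by (simp add: q coeff_B_Suc_Suc numeral_2_eq_2)
  also have "(\<Prod>j = 2..p - 1. ratio_B m l j) = (\<Prod>j = 2..p - 1.
      (l - m j / m (j - 1) * (m (j - 1) / m (j - 2) + 2)) / (2 * m (j + 1) / m j))"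
    by (rule prod.cong) (auto simp: ratio_B_def diag_B_def eigval_B_def)
  finally show ?thesis
    by (simp add: coeff_B_small[of m l, OF pos m0])
qed

text \<open>Brings the separate closed formulas for n = 2 and n \<ge> 3 to one form, so that the
  theorem can work with the recurrence alone.\<close>

lemma coeff_moment_Bessel_poly:
  assumes pos: "\<And>p. m p > 0" and m0: "m 0 = 1" and n: "n \<ge> 2"
  shows "coeff (moment_Bessel_poly m n a0) p = a0 * complex_of_real (coeff_B m (eigval_B m n) p)"
proof -
  note small = coeff_B_small[of m "eigval_B m n", OF pos m0]
  have nz: "m q \<noteq> 0" for q
    using pos[of q] by simp
  consider "p = 0" | "p = 1" | "p = 2" | "p \<ge> 3" "p \<le> n" | "p \<ge> 3" "p > n"
    by linarith
  note p_cases = this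
  show ?thesis
  proof (cases "n = 2")
    case True
    have l: "eigval_B m 2 = m 2 / m 1 * (m 1 + 2)"
      by (simp add: eigval_B_def m0)
    have c1: "(2 + m 1) * m 2 / (2 * m 1 ^ 2) = coeff_B m (eigval_B m n) 1"
      unfolding small(2) unfolding True l using nz[of 1] by (simp add: field_simps power2_eq_square)
    have c2: "(2 + m 1) * (- 2 * m 1 ^ 2 + (2 + m 1) * m 2) / (4 * m 1 ^ 2)
        = coeff_B m (eigval_B m n) 2"
      unfolding small(3) unfolding True l using nz[of 1] nz[of 2] by (simp add: field_simps power2_eq_square)
    have P: "moment_Bessel_poly m n a0 = smult a0 [:1, complex_of_real (coeff_B m (eigval_B m n) 1),
        complex_of_real (coeff_B m (eigval_B m n) 2):]"
      unfolding c1[symmetric] c2[symmetric] using True by (simp add: moment_Bessel_poly_def)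
    show ?thesis
      unfolding P using p_cases
      by cases (use True small(1) in
          \<open>auto simp: coeff_pCons numeral_2_eq_2 coeff_B_eq_0 split: nat.split\<close>)
  next
    case False
    let ?l = "eigval_B m n"
    let ?c = "?l / (4 * m 2) * (?l - 2 * m 1)"
    let ?Q = "\<lambda>p. \<Prod>j = 2..p - 1. (?l - m j / m (j - 1) * (m (j - 1) / m (j - 2) + 2))
        / (2 * m (j + 1) / m j)"
    have "coeff (moment_Bessel_poly m n a0) p = a0 *
       ((if p = 0 then 1 else 0) + (if p = 1 then complex_of_real (?l / (2 * m 1)) else 0)
        + (if p = 2 then complex_of_real ?c else 0)
        + complex_of_real ?c * (\<Sum>q = 3..n. if q = p then complex_of_real (?Q q) else 0))"
      using False n unfolding moment_Bessel_poly_def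
      by (simp only: if_False coeff_smult coeff_add coeff_sum coeff_monom coeff_1)
         (auto simp: coeff_sum coeff_1 intro!: sum.cong)
    also have "\<dots> = a0 *
       ((if p = 0 then 1 else 0) + (if p = 1 then complex_of_real (?l / (2 * m 1)) else 0)
        + (if p = 2 then complex_of_real ?c else 0)
        + complex_of_real ?c * (if p \<in> {3..n} then complex_of_real (?Q p) else 0))"
      by (simp only: sum.delta finite_atLeastAtMost)
    \<comment> \<open>At most one summand survives for each p; for p > n none does, and the right
      side vanishes too.\<close>
    also have "\<dots> = a0 * complex_of_real (coeff_B m ?l p)"
      using p_cases
    proof cases
      case 4
      then show ?thesis
        unfolding coeff_B_ge_3[of m p ?l, OF pos m0 4(1)] by simp
    next
      case 5
      then show ?thesis
        using n by (simp add: coeff_B_eq_0)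
    qed (use small in simp_all)
    finally show ?thesis .
  qed
qed

text \<open>The factor j = 0 is nonzero because the eigenvalue is positive; the factors 1 \<le> j <
  n give the conditions of \<open>nonresonant_B\<close> one by one.\<close>

lemma coeff_B_nonzero_iff:
  assumes pos: "\<And>p. m p > 0" and m0: "m 0 = 1" and n: "n \<ge> 2"
  shows "coeff_B m (eigval_B m n) n \<noteq> 0 \<longleftrightarrow> nonresonant_B m n"
proof -
  have nz: "m q \<noteq> 0" for q
    using pos[of q] by simp
  have "eigval_B m n > 0"
    unfolding eigval_B_def using pos by (simp add: add_pos_pos)
  moreover have "{..<n} = {0, 1} \<union> {2..<n}"
    using n by auto
  ultimately show ?thesis
    using n by (auto simp: coeff_B_def ratio_B_def diag_B_def nz nonresonant_B_def)
qed

theorem proposition4: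
  fixes m :: "nat \<Rightarrow> real" and n :: nat and a0 :: complex
  assumes "\<And>p. m p > 0" and "m 0 = 1" and "n \<ge> 1" and "a0 \<noteq> 0"
  shows "moment_Bessel_eq m n (fps_of_poly (moment_Bessel_poly m n a0))
    \<and> degree (moment_Bessel_poly m n a0) \<le> n
    \<and> (degree (moment_Bessel_poly m n a0) = n \<longleftrightarrow> nonresonant_B m n)"
proof (cases "n = 1")
  case True
  have P: "fps_of_poly [:a0, a0:] = fps_const a0 * (fps_X + 1)"
    by (simp add: fps_of_poly_pCons algebra_simps)
 \<comment> \<open>Since m(0) = 1, \<partial>_m x = m(1).\<close>
 have "moment_deriv m (fps_const a0 * (fps_X + 1)) = fps_const (a0 * complex_of_real (m 1))"
    using assms(2) by (auto simp: moment_deriv_def fps_eq_iff fps_X_def)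
  then have "(fps_X + 1) * moment_deriv m (fps_of_poly [:a0, a0:])
      = fps_const (complex_of_real (m 1)) * fps_of_poly [:a0, a0:]"
    unfolding P by (simp add: mult_ac flip: fps_const_mult)
  then show ?thesis
    using True assms(4)
    by (simp add: moment_Bessel_eq_def moment_Bessel_poly_def nonresonant_B_def)
next
  case False
  then have n: "n \<ge> 2"
    using assms(3) by simp
  let ?P = "moment_Bessel_poly m n a0" and ?l = "eigval_B m n"
  note coeff_P = coeff_moment_Bessel_poly[of m n a0, OF assms(1,2) n]
  have nz: "m q \<noteq> 0" for q
    using assms(1)[of q] by simp
  \<comment> \<open>Passing from p to p + 1 multiplies \<open>coeff_B\<close> by
    \<open>ratio_B m ?l p\<close>; clearing its denominator gives the recurrence.\<close>
  have rec: "diag_B m p * coeff_B m ?l p + 2 * m (p + 1) / m p * coeff_B m ?l (p + 1)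
      = ?l * coeff_B m ?l p" for p
    using nz[of p] nz[of "p + 1"] by (simp add: coeff_B_def ratio_B_def field_simps)
  have "complex_of_real (diag_B m p) * fps_nth (fps_of_poly ?P) p
      + complex_of_real (2 * m (p + 1) / m p) * fps_nth (fps_of_poly ?P) (p + 1)
      = complex_of_real ?l * fps_nth (fps_of_poly ?P) p" for p
    using arg_cong[OF rec[of p], of "\<lambda>x. a0 * complex_of_real x"]
    by (simp add: coeff_P algebra_simps)
  then have "fps_nth (fps_X ^ 2 * moment_deriv m (moment_deriv m (fps_of_poly ?P))
                  + 2 * (fps_X + 1) * moment_deriv m (fps_of_poly ?P)) p
      = fps_nth (fps_const (complex_of_real ?l) * fps_of_poly ?P) p" for p
    using Bessel_operator_nth[of m "fps_of_poly ?P" p, OF assms(1,2)]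
    by (simp only: fps_mult_left_const_nth)
  then have "moment_Bessel_eq m n (fps_of_poly ?P)"
    using False by (simp only: moment_Bessel_eq_def if_False right_minus_eq) (rule fps_ext)
  moreover have le: "degree ?P \<le> n"
    by (rule degree_le) (simp add: coeff_P coeff_B_eq_0 n)
  \<comment> \<open>If the degree is n, then the n-th coefficient is the leading one; it could
    vanish only for the zero polynomial, whose degree 0 is less than n.\<close>
  moreover have "degree ?P = n \<longleftrightarrow> coeff ?P n \<noteq> 0"
    using le n le_degree[of ?P n] by (metis degree_0 le_antisym leading_coeff_0_iff not_numeral_le_zero)
  ultimately show ?thesis
    using coeff_B_nonzero_iff[of m n, OF assms(1,2) n] assms(4) by (simp add: coeff_P)
qed

end
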